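(* Let $f\in\mathcal{S}^*_B$ have logarithmic coefficients $\gamma_1,\gamma_2,\dots$, and let $\mathcal{T}_{2,1}(F_f/2)=\gamma_1^2-\gamma_2^2$. Then $$|\mathcal{T}_{2,1}(F_f/2)|\le\frac{17}{64}.$$ This inequality is sharp, i.e. equality holds for some function in $\mathcal{S}^*_B$.
   Context: Let $\mathbb{D}=\{z\in\mathbb{C}:|z|<1\}$ and let $\mathcal{A}$ be the class of analytic functions $f$ on $\mathbb{D}$ with $f(0)=0$, $f'(0)=1$, written $f(z)=z+\sum_{n=2}^\infty a_nz^n$. For analytic functions $g,h$ on $\mathbb{D}$, $g\prec h$ ($g$ is subordinate to $h$) means $g(z)=h(w(z))$ on $\mathbb{D}$ for some analytic $w:\mathbb{D}\to\mathbb{D}$ with $w(0)=0$. Let $B(z)=\dfrac{1}{1-\log(1+z)}$ on $\mathbb{D}$ (principal branch of the logarithm), and let $$\mathcal{S}^*_B=\left\{f\in\mathcal{A}:\ \frac{zf'(z)}{f(z)}\prec B(z)\right\}.$$ The logarithmic coefficients $\gamma_n$ of $f$ are defined by $F_f(z)=\log\frac{f(z)}{z}=2\sum_{n=1}^\infty\gamma_nz^n$ (the branch vanishing at $z=0$). Thus $\gamma_1=\frac12a_2$ and $\gamma_2=\frac12\left(a_3-\frac12a_2^2\right)$. *)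

theory Defs
  imports "HOL-Complex_Analysis.Complex_Analysis"
begin

abbreviation unit_disc :: "complex set" where
  "unit_disc \<equiv> ball 0 1"

definition class_A :: "(complex \<Rightarrow> complex) set" where
  "class_A = {f. f holomorphic_on unit_disc \<and> f 0 = 0 \<and> deriv f 0 = 1}"

definition subordinate :: "(complex \<Rightarrow> complex) \<Rightarrow> (complex \<Rightarrow> complex) \<Rightarrow> bool"
  (infix "\<prec>\<^sub>s" 50) where
  "g \<prec>\<^sub>s h \<longleftrightarrow>
     g holomorphic_on unit_disc \<and> h holomorphic_on unit_disc \<and>
     (\<exists>w. w holomorphic_on unit_disc \<and> w ` unit_disc \<subseteq> unit_disc \<and> w 0 = 0 \<and>
          (\<forall>z\<in>unit_disc. g z = h (w z)))"

definition B_fun :: "complex \<Rightarrow> complex" where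
  "B_fun z = 1 / (1 - Ln (1 + z))"

text \<open>The removable singularity of \<open>z f'(z) / f(z)\<close> at the origin is filled with its limit 1.
  At a zero \<open>z \<noteq> 0\<close> of \<open>f\<close> the quotient has the value 0 by the convention \<open>x / 0 = 0\<close>; as
  \<open>B_fun\<close> does not vanish on the unit disc, membership in \<open>starlike_B\<close> excludes such zeros
  (lemma \<open>starlike_B_nonzero\<close>).\<close>

definition star_quotient :: "(complex \<Rightarrow> complex) \<Rightarrow> complex \<Rightarrow> complex" where
  "star_quotient f z = (if z = 0 then 1 else z * deriv f z / f z)"

definition starlike_B :: "(complex \<Rightarrow> complex) set" where
  "starlike_B = {f \<in> class_A. star_quotient f \<prec>\<^sub>s B_fun}"

text \<open>The holomorphic branch on the unit disc of \<open>log (f(z) / z)\<close> that vanishes at 0. For \<open>f\<close> in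
  \<open>starlike_B\<close> it exists (lemma \<open>log_quotient_works\<close>), and it is unique on the disc. The principal
  logarithm of \<open>f(z) / z\<close> need not be continuous on the whole disc.\<close>

definition is_log_quotient :: "(complex \<Rightarrow> complex) \<Rightarrow> (complex \<Rightarrow> complex) \<Rightarrow> bool" where
  "is_log_quotient f F \<longleftrightarrow>
     F holomorphic_on unit_disc \<and> F 0 = 0 \<and> (\<forall>z\<in>unit_disc - {0}. exp (F z) = f z / z)"

definition log_quotient :: "(complex \<Rightarrow> complex) \<Rightarrow> complex \<Rightarrow> complex" where
  "log_quotient f = (SOME F. is_log_quotient f F)"

definition log_coeff :: "(complex \<Rightarrow> complex) \<Rightarrow> nat \<Rightarrow> complex" where
  "log_coeff f n = fps_nth (fps_expansion (log_quotient f) 0) n / 2"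

definition toeplitz_2_1_log :: "(complex \<Rightarrow> complex) \<Rightarrow> complex" where
  "toeplitz_2_1_log f = (log_coeff f 1)\<^sup>2 - (log_coeff f 2)\<^sup>2"

lemma one_minus_Ln_nonzero:
  assumes "z \<in> unit_disc"
  shows "1 - Ln (1 + z) \<noteq> 0"
proof
  assume "1 - Ln (1 + z) = 0"
  then have L: "Ln (1 + z) = 1" by simp
  have "1 + z \<noteq> 0"
    using assms by (metis add_eq_0_iff mem_ball_0 norm_minus_cancel norm_one order_less_irrefl)
  then have "exp 1 = 1 + z" using exp_Ln[of "1 + z"] L by simp
  then have z: "z = of_real (exp 1 - 1)" by (simp add: exp_of_real[symmetric] algebra_simps)
  have "norm z = \<bar>exp 1 - 1\<bar>" unfolding z norm_of_real ..
  moreover have "exp (1::real) \<ge> 2" using exp_ge_add_one_self[of "1::real"] by simp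
  ultimately show False using assms by simp
qed

lemma starlike_B_nonzero:
  assumes f: "f \<in> starlike_B" and z: "z \<in> unit_disc - {0}"
  shows "f z \<noteq> 0"
proof
  assume fz: "f z = 0"
  obtain w where w: "w ` unit_disc \<subseteq> unit_disc" "\<forall>z\<in>unit_disc. star_quotient f z = B_fun (w z)"
    using f by (auto simp: starlike_B_def subordinate_def)
  then have "star_quotient f z = B_fun (w z)" "w z \<in> unit_disc" using z by blast+
  then show False
    using fz z one_minus_Ln_nonzero[of "w z"] by (auto simp: star_quotient_def B_fun_def)
qed

lemma log_quotient_works:
  assumes f: "f \<in> starlike_B"
  shows "is_log_quotient f (log_quotient f)"
proof -
  define g where "g = (\<lambda>z. if z = 0 then deriv f 0 else (f z - f 0) / (z - 0))"
  have A: "f holomorphic_on unit_disc" "f 0 = 0" "deriv f 0 = 1"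
    using f by (auto simp: starlike_B_def class_A_def)
  have "g holomorphic_on unit_disc"
    unfolding g_def by (rule pole_lemma_open[OF A(1)]) simp
  moreover have "g z \<noteq> 0" if "z \<in> unit_disc" for z
    using starlike_B_nonzero[OF f, of z] that A by (auto simp: g_def)
  ultimately obtain G where G: "G holomorphic_on unit_disc" "\<And>z. z \<in> unit_disc \<Longrightarrow> g z = exp (G z)"
    using contractible_imp_holomorphic_log[of g unit_disc]
    by (metis convex_ball convex_imp_contractible)
  have e0: "exp (G 0) = 1" using G(2)[of 0] A by (simp add: g_def)
  have "is_log_quotient f (\<lambda>z. G z - G 0)"
    unfolding is_log_quotient_def
  proof (intro conjI ballI)
    show "(\<lambda>z. G z - G 0) holomorphic_on unit_disc" by (intro holomorphic_intros G)
    fix z assume z: "z \<in> unit_disc - {0}"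
    then show "exp (G z - G 0) = f z / z"
      using G(2)[of z] e0 A by (simp add: exp_diff g_def)
  qed simp
  then show ?thesis unfolding log_quotient_def by (rule someI[where P = "is_log_quotient f"])
qed

lemma log_quotient_sums:
  assumes f: "f \<in> starlike_B" and z: "z \<in> unit_disc"
  shows "(\<lambda>n. 2 * log_coeff f (Suc n) * z ^ Suc n) sums log_quotient f z"
proof -
  have L: "log_quotient f holomorphic_on unit_disc" "log_quotient f 0 = 0"
    using log_quotient_works[OF f] by (auto simp: is_log_quotient_def)
  have "(\<lambda>n. 2 * log_coeff f n * z ^ n) sums log_quotient f z"
    using holomorphic_power_series[OF L(1) z] by (simp add: log_coeff_def fps_expansion_def)
  moreover have "log_coeff f 0 = 0" using L(2) by (simp add: log_coeff_def fps_expansion_def)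
  ultimately show ?thesis using sums_Suc_iff[of "\<lambda>n. 2 * log_coeff f n * z ^ n"] by simp
qed

end

(* Writing z f'/f = B o w with a Schwarz function w = c1 z + c2 z^2 + ... and comparing coefficients in
   1 + z F' = B o w, where B = 1 + z + z^2/2 + ..., gives gamma_1 = c1/2 and
   gamma_2 = (c2 + c1^2/2)/4. With |c2| <= 1 - x, where x = |c1|^2 (Schwarz-Pick for w(z)/z at 0), the
   triangle inequality bounds the determinant by x/4 + (1 - x/2)^2/16, which increases on [0,1]
   to 17/64. Equality needs gamma_1^2 and gamma_2^2 of opposite sign, which w = i z achieves. *)

theory Submission
  imports Defs
begin

lemma has_fps_expansion_coeff_deriv:
  fixes f :: "complex \<Rightarrow> complex"
  assumes "f has_fps_expansion F"
  shows "fps_nth F 1 = deriv f 0"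
  using fps_nth_fps_expansion[OF assms, of 1] by simp

text \<open>This turns functional equations on the disc into identities of formal power series,
  whose coefficients can then be compared.\<close>

lemma has_fps_expansion_eq_on_disc:
  fixes f g :: "complex \<Rightarrow> complex"
  assumes "f has_fps_expansion F" "g has_fps_expansion G" "\<And>z. z \<in> unit_disc \<Longrightarrow> f z = g z"
  shows "F = G"
proof -
  have "eventually (\<lambda>z. z \<in> unit_disc) (nhds 0)"
    by (intro eventually_nhds_in_open) auto
  then have "eventually (\<lambda>z. f z = g z) (nhds 0)"
    by eventually_elim (rule assms(3))
  then have "g has_fps_expansion F"
    using assms(1) has_fps_expansion_cong by blast
  then show ?thesis
    using assms(2) fps_expansion_unique_complex by blast
qed

lemma holomorphic_on_disc_has_fps_expansion:
  "f holomorphic_on unit_disc \<Longrightarrow> f has_fps_expansion fps_expansion f 0"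
  by (rule has_fps_expansion_fps_expansion) auto

text \<open>This is Schwarz-Pick at the origin. The disc automorphism \<open>M\<close> moves
  \<open>h 0\<close> to 0, so the Schwarz lemma applies to \<open>M \<circ> h\<close>; the factor
  \<open>M\<close> contributes to the derivative at 0 is the reciprocal of 1 - |h(0)|^2.\<close>

lemma Schwarz_Pick_deriv_0:
  assumes h: "h holomorphic_on unit_disc" and lt: "\<And>z. norm z < 1 \<Longrightarrow> norm (h z) < 1"
  shows "norm (deriv h 0) \<le> 1 - (norm (h 0))\<^sup>2"
proof -
  define M where "M = Moebius_function 0 (h 0)"
  have h0: "norm (h 0) < 1" using lt by simp
  have "h ` unit_disc \<subseteq> unit_disc" using lt by auto
  then have hol: "(M \<circ> h) holomorphic_on unit_disc"
    unfolding M_def using holomorphic_on_compose_gen h Moebius_function_holomorphic[OF h0] by blast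
  have "norm (deriv (M \<circ> h) 0) \<le> 1"
  proof (rule Schwarz_Lemma(2)[OF hol, of 0])
    show "(M \<circ> h) 0 = 0" by (simp add: M_def Moebius_function_eq_zero)
    show "norm ((M \<circ> h) z) < 1" if "norm z < 1" for z
      using Moebius_function_norm_lt_1[OF h0 lt[OF that]] by (simp add: M_def)
  qed simp
  \<comment> \<open>The numerator of \<open>M\<close> vanishes at \<open>h 0\<close>, so only one
    term of the quotient rule survives.\<close>
  moreover have "deriv (M \<circ> h) 0 = deriv h 0 / (1 - cnj (h 0) * h 0)"
  proof (rule DERIV_imp_deriv)
    have ne: "1 - cnj (h 0) * h 0 \<noteq> 0"
      using h0 by (metis complex_mod_cnj norm_ge_zero norm_mult norm_one mult_less_cancel_right1
          order_less_irrefl order_less_asym right_minus_eq mult.commute)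
    have d: "(h has_field_derivative deriv h 0) (at 0)"
      using h holomorphic_derivI[of h unit_disc 0] by simp
    show "((M \<circ> h) has_field_derivative deriv h 0 / (1 - cnj (h 0) * h 0)) (at 0)"
      unfolding M_def o_def Moebius_function_simple
      by (rule derivative_eq_intros d refl ne)+ (use ne in simp)
  qed
  moreover have "1 - cnj (h 0) * h 0 = of_real (1 - (norm (h 0))\<^sup>2)"
    using complex_norm_square[of "h 0"] by (simp add: mult.commute)
  moreover have "1 - (norm (h 0))\<^sup>2 > 0"
    using h0 by (simp add: power_less_one_iff abs_square_less_1)
  ultimately show ?thesis
    by (simp only: norm_divide norm_of_real) (simp add: field_simps)
qed

text \<open>Dividing by z shifts the coefficients: h(z) = w(z)/z has h(0) = c1 and h'(0) = c2, so
  Schwarz-Pick for h gives the bound.\<close>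

lemma Schwarz_second_coeff:
  assumes w: "w holomorphic_on unit_disc" "w 0 = 0" and lt: "\<And>z. norm z < 1 \<Longrightarrow> norm (w z) < 1"
  defines "W \<equiv> fps_expansion w 0"
  shows "norm (fps_nth W 2) \<le> 1 - (norm (fps_nth W 1))\<^sup>2"
proof -
  have W: "w has_fps_expansion W"
    unfolding W_def by (rule holomorphic_on_disc_has_fps_expansion[OF w(1)])
  have W0: "fps_nth W 0 = 0" using fps_nth_fps_expansion[OF W, of 0] w by simp
  have W1: "fps_nth W 1 = deriv w 0" by (rule has_fps_expansion_coeff_deriv[OF W])
  \<comment> \<open>A rotation has to be treated apart: there w(z)/z is a constant of modulus 1,
    hence no map into the open disc. The claim then reads 0 \<le> 0.\<close>
  show ?thesis
  proof (cases "\<exists>\<alpha>. (\<forall>z. norm z < 1 \<longrightarrow> w z = \<alpha> * z) \<and> norm \<alpha> = 1")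
    case True
    then obtain \<alpha> where a: "\<And>z. norm z < 1 \<Longrightarrow> w z = \<alpha> * z" "norm \<alpha> = 1" by blast
    have "W = fps_const \<alpha> * fps_X"
      by (rule has_fps_expansion_eq_on_disc[OF W has_fps_expansion_cmult_left[OF has_fps_expansion_fps_X]])
         (simp add: a)
    then show ?thesis using a by simp
  next
    case False
    define h where "h z = (if z = 0 then deriv w 0 else (w z - w 0) / (z - 0))" for z
    have hol: "h holomorphic_on unit_disc"
      unfolding h_def by (rule pole_lemma_open[OF w(1)]) simp
    \<comment> \<open>Equality in the Schwarz lemma, either for the derivative at 0 or at some other
      point, would make \<open>w\<close> a rotation. So both inequalities are strict here.\<close>
    have "norm (h z) < 1" if z: "norm z < 1" for z
    proof (cases "z = 0")
      case True
      then show ?thesis using Schwarz_Lemma(2,3)[OF w lt, of 0] False by (force simp: h_def)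
    next
      case nz: False
      then have "norm (w z) < norm z" using Schwarz_Lemma(1,3)[OF w lt z] False z by fastforce
      then show ?thesis using nz by (simp add: h_def w norm_divide)
    qed
    then have "norm (deriv h 0) \<le> 1 - (norm (h 0))\<^sup>2"
      by (rule Schwarz_Pick_deriv_0[OF hol])
    moreover have "deriv h 0 = fps_nth W 2"
    proof -
      note H = holomorphic_on_disc_has_fps_expansion[OF hol]
      have "W = fps_X * fps_expansion h 0"
        by (rule has_fps_expansion_eq_on_disc[OF W has_fps_expansion_mult[OF has_fps_expansion_fps_X H]])
           (auto simp: h_def w)
      then have "fps_nth W 2 = fps_nth (fps_expansion h 0) 1" by (simp add: numeral_2_eq_2)
      then show ?thesis using has_fps_expansion_coeff_deriv[OF H] by simp
    qed
    ultimately show ?thesis unfolding W1 by (simp add: h_def)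
  qed
qed

lemma one_plus_notin_nonpos_Reals:
  assumes "z \<in> unit_disc"
  shows "1 + z \<notin> \<real>\<^sub>\<le>\<^sub>0"
proof -
  have "Re (1 + z) > 0"
    using assms abs_Re_le_cmod[of z] by simp
  then show ?thesis by (auto simp: complex_nonpos_Reals_iff)
qed

text \<open>Writing the derivative through \<open>B_fun\<close> itself exhibits a differential
  equation, which yields the Taylor coefficients without expanding the logarithm.\<close>

lemma B_fun_has_field_derivative:
  assumes z: "z \<in> unit_disc"
  shows "(B_fun has_field_derivative (B_fun z)\<^sup>2 / (1 + z)) (at z)"
proof -
  note nz = one_minus_Ln_nonzero[OF z] one_plus_notin_nonpos_Reals[OF z]
  have "1 + z \<noteq> 0" using nz(2) by auto
  then show ?thesis
    unfolding B_fun_def[abs_def] using nz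
    by (auto intro!: derivative_eq_intros simp: field_simps power2_eq_square)
qed

lemma B_fun_holomorphic: "B_fun holomorphic_on unit_disc"
  unfolding holomorphic_on_open[OF open_ball] using B_fun_has_field_derivative by blast

lemma B_fun_0 [simp]: "B_fun 0 = 1"
  by (simp add: B_fun_def)

text \<open>The coefficients are read off the Riccati equation \<open>(1 + z) B'(z) = B(z)\<^sup>2\<close>.\<close>

lemma B_fun_coeffs:
  defines "P \<equiv> fps_expansion B_fun 0"
  shows "fps_nth P 0 = 1" "fps_nth P 1 = 1" "fps_nth P 2 = 1 / 2"
proof -
  have P: "B_fun has_fps_expansion P"
    unfolding P_def by (rule holomorphic_on_disc_has_fps_expansion[OF B_fun_holomorphic])
  show P0: "fps_nth P 0 = 1" using fps_nth_fps_expansion[OF P, of 0] by simp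
  have "(1 + fps_X) * fps_deriv P = P * P"
  proof (rule has_fps_expansion_eq_on_disc)
    show "(\<lambda>z. (1 + z) * deriv B_fun z) has_fps_expansion (1 + fps_X) * fps_deriv P"
      by (intro fps_expansion_intros P)
    show "(\<lambda>z. B_fun z * B_fun z) has_fps_expansion P * P"
      by (intro fps_expansion_intros P)
    show "(1 + z) * deriv B_fun z = B_fun z * B_fun z" if "z \<in> unit_disc" for z
      using DERIV_imp_deriv[OF B_fun_has_field_derivative[OF that]]
        one_plus_notin_nonpos_Reals[OF that]
      by (auto simp: power2_eq_square)
  qed
  then have *: "fps_nth ((1 + fps_X) * fps_deriv P) n = fps_nth (P * P) n" for n by simp
  show P1: "fps_nth P 1 = 1"
    using *[of 0] P0 by (simp add: algebra_simps)
  \<comment> \<open>The coefficient of z in the equation gives 2 p2 + p1 = 2 p0 p1.\<close>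
  show "fps_nth P 2 = 1 / 2"
    using *[of 1] P0 P1 by (simp add: algebra_simps fps_mult_nth numeral_2_eq_2)
qed

text \<open>Logarithmic differentiation of f = z exp(L) turns the subordination into an equation for
  L' alone. The coefficients of L are twice the logarithmic coefficients.\<close>

lemma starlike_B_log_coeffs:
  assumes f: "f \<in> starlike_B"
    and w: "w holomorphic_on unit_disc" "w ` unit_disc \<subseteq> unit_disc" "w 0 = 0"
    and eq: "\<forall>z\<in>unit_disc. star_quotient f z = B_fun (w z)"
  defines "W \<equiv> fps_expansion w 0"
  shows "log_coeff f 1 = fps_nth W 1 / 2"
    and "log_coeff f 2 = (fps_nth W 2 + (fps_nth W 1)\<^sup>2 / 2) / 4"
proof -
  define L where "L = log_quotient f"
  have A: "f holomorphic_on unit_disc" "f 0 = 0"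
    using f by (auto simp: starlike_B_def class_A_def)
  have L: "L holomorphic_on unit_disc" "\<And>z. z \<in> unit_disc - {0} \<Longrightarrow> exp (L z) = f z / z"
    using log_quotient_works[OF f] by (auto simp: is_log_quotient_def L_def)
  \<comment> \<open>Unlike the quotient form, this product form also holds at the origin, where both
    sides vanish.\<close>
  have fL: "f z = z * exp (L z)" if "z \<in> unit_disc" for z
    using L(2)[of z] that A by (cases "z = 0") auto
  have sq: "star_quotient f z = 1 + z * deriv L z" if z: "z \<in> unit_disc" for z
  proof (cases "z = 0")
    case False
    have dL: "(L has_field_derivative deriv L z) (at z)"
      using L(1) z holomorphic_derivI by blast
    have "((\<lambda>z. z * exp (L z)) has_field_derivative (1 + z * deriv L z) * exp (L z)) (at z)"
      by (rule derivative_eq_intros dL refl)+ (simp add: algebra_simps)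
    then have "(f has_field_derivative (1 + z * deriv L z) * exp (L z)) (at z)"
      by (rule has_field_derivative_transform_within_open[where S = unit_disc]) (use z fL in auto)
    then have "deriv f z = (1 + z * deriv L z) * exp (L z)" by (rule DERIV_imp_deriv)
    then show ?thesis using False z by (simp add: star_quotient_def fL)
  qed (simp add: star_quotient_def)
  define Q where "Q = fps_expansion L 0"
  define P where "P = fps_expansion B_fun 0"
  have W: "w has_fps_expansion W" and Q: "L has_fps_expansion Q" and P: "B_fun has_fps_expansion P"
    unfolding W_def Q_def P_def
    by (intro holomorphic_on_disc_has_fps_expansion w L B_fun_holomorphic)+
  \<comment> \<open>A vanishing constant term is what lets \<open>fps_compose\<close> represent the
    composite function.\<close>
  have W0: "fps_nth W 0 = 0" using fps_nth_fps_expansion[OF W, of 0] w by simp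
  have "1 + fps_X * fps_deriv Q = fps_compose P W"
  proof (rule has_fps_expansion_eq_on_disc)
    show "(\<lambda>z. 1 + z * deriv L z) has_fps_expansion 1 + fps_X * fps_deriv Q"
      by (intro fps_expansion_intros Q)
    show "(B_fun \<circ> w) has_fps_expansion fps_compose P W"
      by (intro fps_expansion_intros P W W0)
    show "1 + z * deriv L z = (B_fun \<circ> w) z" if "z \<in> unit_disc" for z
      using sq[OF that] eq that by simp
  qed
  then have *: "fps_nth (1 + fps_X * fps_deriv Q) n = fps_nth (fps_compose P W) n" for n by simp
  note p = B_fun_coeffs[folded P_def]
  have q1: "fps_nth Q 1 = fps_nth W 1"
    using *[of 1] p W0 by (simp add: fps_compose_nth)
  \<comment> \<open>The coefficient of z^2 in B(w(z)) is p1 c2 + p2 c1^2, with p1 = 1 and p2 =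
    1/2.\<close>
  have q2: "2 * fps_nth Q 2 = fps_nth W 2 + (fps_nth W 1)\<^sup>2 / 2"
    using *[of 2] p W0
    by (simp add: fps_compose_nth numeral_2_eq_2 fps_mult_nth power2_eq_square)
  show "log_coeff f 1 = fps_nth W 1 / 2"
    using q1 by (simp add: log_coeff_def Q_def L_def)
  show "log_coeff f 2 = (fps_nth W 2 + (fps_nth W 1)\<^sup>2 / 2) / 4"
    using q2 by (simp add: log_coeff_def Q_def L_def field_simps)
qed

lemma toeplitz_bound:
  fixes a b :: complex
  assumes "norm b \<le> 1 - (norm a)\<^sup>2"
  shows "norm ((a / 2)\<^sup>2 - ((b + a\<^sup>2 / 2) / 4)\<^sup>2) \<le> 17 / 64"
proof -
  define x where "x = (norm a)\<^sup>2"
  have x: "0 \<le> x" "x \<le> 1" using assms norm_ge_zero[of b] unfolding x_def by (simp, linarith)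
  have "norm (b + a\<^sup>2 / 2) \<le> norm b + norm (a\<^sup>2 / 2)" by (rule norm_triangle_ineq)
  also have "\<dots> \<le> 1 - x / 2" using assms by (simp add: x_def norm_power norm_divide)
  finally have "(norm (b + a\<^sup>2 / 2))\<^sup>2 \<le> (1 - x / 2)\<^sup>2" by (intro power_mono) auto
  moreover have "norm ((a / 2)\<^sup>2 - ((b + a\<^sup>2 / 2) / 4)\<^sup>2) \<le> norm ((a / 2)\<^sup>2) + norm (((b + a\<^sup>2 / 2) / 4)\<^sup>2)"
    by (rule norm_triangle_ineq4)
  moreover have "norm ((a / 2)\<^sup>2) = x / 4" by (simp add: x_def norm_power norm_divide power_divide)
  moreover have "norm (((b + a\<^sup>2 / 2) / 4)\<^sup>2) = (norm (b + a\<^sup>2 / 2))\<^sup>2 / 16"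
    by (simp add: norm_power norm_divide power_divide)
  \<comment> \<open>The bound expands to 1/16 + 3x/16 + x^2/64. With \<open>x * x\<close> treated as
    an atom it is linear, and x \<le> 1, x^2 \<le> 1 give 4/64 + 12/64 + 1/64.\<close>
  moreover have "(1 - x / 2)\<^sup>2 = 1 - x + x * x / 4" by (simp add: power2_eq_square field_simps)
  moreover have "x * x \<le> 1" using x by (simp add: mult_le_one)
  ultimately show ?thesis using x by linarith
qed

text \<open>The equation z f'/f = B(w) is solved by f(z) = z exp(G(z)), where G is the primitive of
  (B(w(z)) - 1)/z with G(0) = 0. So every Schwarz function comes from some member of the
  class.\<close>

lemma starlike_B_subordinate_exists:
  assumes w: "w holomorphic_on unit_disc" "w ` unit_disc \<subseteq> unit_disc" "w 0 = 0"
  obtains f where "f \<in> starlike_B" "\<forall>z\<in>unit_disc. star_quotient f z = B_fun (w z)"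
proof -
  define g where "g = B_fun \<circ> w"
  have g: "g holomorphic_on unit_disc" "g 0 = 1"
    using holomorphic_on_compose_gen[OF w(1) B_fun_holomorphic w(2)] w(3) by (auto simp: g_def)
  \<comment> \<open>This is (B(w(z)) - 1)/z with its removable singularity at 0 filled in.\<close>
  define k where "k z = (if z = 0 then deriv g 0 else (g z - g 0) / (z - 0))" for z
  have k: "k holomorphic_on unit_disc"
    unfolding k_def by (rule pole_lemma_open[OF g(1)]) simp
  obtain G0 where G0: "\<And>z. z \<in> unit_disc \<Longrightarrow> (G0 has_field_derivative k z) (at z within unit_disc)"
    using holomorphic_convex_primitive'[OF convex_ball open_ball k] by blast
  \<comment> \<open>The constant of integration is chosen so that f'(0) = exp(G(0)) = 1.\<close>
  define G where "G z = G0 z - G0 0" for z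
  have G: "(G has_field_derivative k z) (at z)" if "z \<in> unit_disc" for z
    unfolding G_def
    by (rule derivative_eq_intros G0[OF that, unfolded at_within_open[OF that open_ball]] refl)+ simp
  define f where "f z = z * exp (G z)" for z
  have df: "(f has_field_derivative (1 + z * k z) * exp (G z)) (at z)" if "z \<in> unit_disc" for z
    unfolding f_def by (rule derivative_eq_intros G[OF that] refl)+ (simp add: algebra_simps)
  have "f holomorphic_on unit_disc"
    unfolding holomorphic_on_open[OF open_ball] using df by blast
  moreover have "deriv f 0 = 1" using DERIV_imp_deriv[OF df[of 0]] by (simp add: G_def)
  ultimately have "f \<in> class_A" by (simp add: class_A_def f_def)
  moreover have sq: "star_quotient f z = B_fun (w z)" if "z \<in> unit_disc" for z
    using DERIV_imp_deriv[OF df[OF that]] g(2) w(3)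
    by (auto simp: star_quotient_def f_def k_def g_def)
  moreover have "star_quotient f holomorphic_on unit_disc"
    using holomorphic_transform[OF g(1)] sq by (simp add: g_def)
  ultimately have "f \<in> starlike_B"
    using w B_fun_holomorphic unfolding starlike_B_def subordinate_def by blast
  then show ?thesis using sq that by blast
qed

theorem theorem4p4:
  shows "(\<forall>f \<in> starlike_B. norm (toeplitz_2_1_log f) \<le> 17 / 64) \<and>
         (\<exists>f \<in> starlike_B. norm (toeplitz_2_1_log f) = 17 / 64)"
proof
  show "\<forall>f \<in> starlike_B. norm (toeplitz_2_1_log f) \<le> 17 / 64"
  proof
    fix f assume f: "f \<in> starlike_B"
    then obtain w where w: "w holomorphic_on unit_disc" "w ` unit_disc \<subseteq> unit_disc" "w 0 = 0"
      and eq: "\<forall>z\<in>unit_disc. star_quotient f z = B_fun (w z)"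
      by (auto simp: starlike_B_def subordinate_def)
    have "norm (w z) < 1" if "norm z < 1" for z using w(2) that by force
    then have "norm (fps_nth (fps_expansion w 0) 2) \<le> 1 - (norm (fps_nth (fps_expansion w 0) 1))\<^sup>2"
      by (rule Schwarz_second_coeff[OF w(1,3)])
    from toeplitz_bound[OF this]
    show "norm (toeplitz_2_1_log f) \<le> 17 / 64"
      unfolding toeplitz_2_1_log_def starlike_B_log_coeffs[OF f w eq] .
  qed
  \<comment> \<open>Here c1 = i and c2 = 0, so the logarithmic coefficients are i/2 and -1/8, and
    the determinant is -1/4 - 1/64.\<close>
  define w where "w z = \<i> * z" for z
  have w: "w holomorphic_on unit_disc" "w ` unit_disc \<subseteq> unit_disc" "w 0 = 0"
    unfolding w_def by (auto intro!: holomorphic_intros simp: norm_mult)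
  obtain f where f: "f \<in> starlike_B" "\<forall>z\<in>unit_disc. star_quotient f z = B_fun (w z)"
    using starlike_B_subordinate_exists[OF w] by blast
  have "fps_expansion w 0 = fps_const \<i> * fps_X"
    by (rule has_fps_expansion_eq_on_disc[OF holomorphic_on_disc_has_fps_expansion[OF w(1)]
          has_fps_expansion_cmult_left[OF has_fps_expansion_fps_X]]) (simp add: w_def)
  then have "toeplitz_2_1_log f = - (17 / 64)"
    unfolding toeplitz_2_1_log_def starlike_B_log_coeffs[OF f(1) w f(2)]
    by (simp add: power_divide)
  then have "norm (toeplitz_2_1_log f) = 17 / 64" by simp
  then show "\<exists>f \<in> starlike_B. norm (toeplitz_2_1_log f) = 17 / 64" using f(1) by blast
qed

end
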